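(* Let $E\subset\mathbb{C}$ be uniformly discrete. Then the set $\mathcal{S}(E)$ consists of finitely many functions.
   Context: Let $\mathbb{D}=\{z\in\mathbb{C}:|z|<1\}$. Let $\mathcal{A}$ be the set of analytic functions $f$ on $\mathbb{D}$ with $f(0)=0$ and $f'(0)=1$, and let $\mathcal{S}$ be the set of univalent (i.e. injective) functions in $\mathcal{A}$. For a subset $E\subset\mathbb{C}$, $\mathcal{A}(E)$ denotes the set of functions $f(z)=z+a_2z^2+a_3z^3+\cdots$ in $\mathcal{A}$ such that $a_n\in E$ for all $n\ge 2$, and $\mathcal{S}(E)=\mathcal{S}\cap\mathcal{A}(E)$. For $a\in\mathbb{C}$ and $r>0$, let $\mathbb{D}(a,r)=\{z\in\mathbb{C}:|z-a|<r\}$. A set $E\subset\mathbb{C}$ is called uniformly discrete (with bound $r_0$) if there is a constant $r_0>0$, independent of $a$, such that $E\cap\mathbb{D}(a,r_0)=\{a\}$ for every $a\in E$. *)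

theory Defs
  imports "HOL-Complex_Analysis.Complex_Analysis"
begin

abbreviation unit_disc :: "complex set" where
  "unit_disc \<equiv> ball 0 1"

text \<open>A function on the disc is represented by the total function that agrees with it there and
  is \<open>undefined\<close> elsewhere (the set \<open>extensional unit_disc\<close>), so that equality of representatives
  is equality of functions on the disc.\<close>

definition class_A :: "(complex \<Rightarrow> complex) set" where
  "class_A = {f \<in> extensional unit_disc. f analytic_on unit_disc \<and> f 0 = 0 \<and> deriv f 0 = 1}"

definition class_S :: "(complex \<Rightarrow> complex) set" where
  "class_S = {f \<in> class_A. inj_on f unit_disc}"

definition class_A_coeffs :: "complex set \<Rightarrow> (complex \<Rightarrow> complex) set" where
  "class_A_coeffs E = {f \<in> class_A. \<forall>n\<ge>2. fps_nth (fps_expansion f 0) n \<in> E}"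

definition class_S_coeffs :: "complex set \<Rightarrow> (complex \<Rightarrow> complex) set" where
  "class_S_coeffs E = class_S \<inter> class_A_coeffs E"

lemma class_A_sums:
  assumes "f \<in> class_A" and "z \<in> unit_disc"
  shows "(\<lambda>n. fps_nth (fps_expansion f 0) n * z ^ n) sums f z"
proof -
  have "f holomorphic_on unit_disc"
    using assms(1) by (auto simp: class_A_def analytic_imp_holomorphic)
  from holomorphic_power_series[OF this assms(2)] show ?thesis
    by (simp add: fps_expansion_def)
qed

lemma uniform_discrete_iff_ball:
  fixes E :: "complex set"
  shows "uniform_discrete E \<longleftrightarrow> (\<exists>r>0. \<forall>a\<in>E. E \<inter> ball a r = {a})"
proof
  assume "uniform_discrete E"
  then obtain r where "r > 0" "\<forall>x\<in>E. \<forall>y\<in>E. dist x y < r \<longrightarrow> x = y"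
    unfolding uniform_discrete_def by blast
  then show "\<exists>r>0. \<forall>a\<in>E. E \<inter> ball a r = {a}"
    by (intro exI[of _ r]) (auto simp: dist_commute)
next
  assume "\<exists>r>0. \<forall>a\<in>E. E \<inter> ball a r = {a}"
  then obtain r where r: "r > 0" "\<forall>a\<in>E. E \<inter> ball a r = {a}" by blast
  have "x = y" if "x \<in> E" "y \<in> E" "dist x y < r" for x y
  proof -
    have "y \<in> E \<inter> ball x r" using that by simp
    then show ?thesis using r(2) that(1) by auto
  qed
  then show "uniform_discrete E" unfolding uniform_discrete_def using r(1) by blast
qed

end

theory Submission
  imports Defs
begin

text \<open>For a univalent \<open>f\<close> write \<open>z / f z = 1 + c\<^sub>1 z + c\<^sub>2 z\<^sup>2 + \<dots>\<close>. If two functions of the class have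
Taylor coefficients \<open>a\<^sub>n\<close> and \<open>b\<^sub>n\<close> that first differ at the index \<open>N\<close>, then the
corresponding quotients \<open>z / f z\<close> first differ at the index \<open>N - 1\<close>, and there the difference is exactly
\<open>b\<^sub>N - a\<^sub>N\<close> (\<open>reciprocal_first_difference\<close>). Area considerations make \<open>c\<^sub>n\<close> tend to zero
uniformly over the class, while uniform discreteness keeps \<open>\<bar>a\<^sub>N - b\<^sub>N\<bar>\<close> above a fixed \<open>r > 0\<close>.
Hence \<open>N\<close> is bounded: a function in the class is determined by a fixed finite number of
its coefficients. These coefficients are bounded (\<open>reciprocal_coefficient_growth\<close>), and a uniformly discrete set has only
finitely many points in a bounded region, so only finitely many functions remain.

The decay of \<open>c\<^sub>n\<close> is Gronwall's area theorem, and only its order of magnitude matters. The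
univalent function \<open>1 / f z = 1 / z + c\<^sub>1 + c\<^sub>2 z + \<dots>\<close> maps the annulus
\<open>\<epsilon> < \<bar>z\<bar> < 1\<close> into the disc of radius \<open>1 / \<epsilon> + C \<epsilon>\<close> about \<open>c\<^sub>1\<close>, for any
\<open>C > \<bar>c\<^sub>2\<bar>\<close> and small \<open>\<epsilon>\<close> (\<open>image_outside_small_disc\<close>, by Brouwer's theorem). Comparing the area of
the image with that of the disc, the leading terms \<open>\<pi> / \<epsilon>\<^sup>2\<close> cancel and what is left is
\<open>k \<bar>c\<^bsub>k+1\<^esub>\<bar>\<^sup>2 \<le> 1 + 2 \<bar>c\<^sub>2\<bar>\<close>. The defect \<open>2 \<bar>c\<^sub>2\<bar>\<close> arises because the image of the circle
\<open>\<bar>z\<bar> = \<epsilon>\<close> is nearly an ellipse, which the disc circumscribes. The case \<open>k = 1\<close> bounds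
\<open>\<bar>c\<^sub>2\<bar>\<close> itself, and so \<open>k \<bar>c\<^bsub>k+1\<^esub>\<bar>\<^sup>2 \<le> 6\<close> (\<open>reciprocal_coefficient_decay\<close>). The remaining
coefficient \<open>c\<^sub>1\<close> is controlled by the fact that \<open>z / f z\<close> has no zero.\<close>

unbundle no fps_syntax

section \<open>Areas of images of injective holomorphic maps\<close>

text \<open>The area of the image is the integral of the Jacobian \<open>\<bar>h'\<bar>\<^sup>2\<close>. The map is
conjugated to \<open>real^2\<close>, where \<open>\<bar>h'\<bar>\<^sup>2\<close> is the determinant of its derivative, and the
integral is then carried over to \<open>real \<times> real\<close> and iterated. The image is
taken of the open rectangle only, since injectivity may fail on its boundary.\<close>

lemma area_injective_holomorphic_le:
  fixes h :: "complex \<Rightarrow> complex"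
  assumes holo: "h holomorphic_on U" "open U" "cbox (Complex a c) (Complex b d) \<subseteq> U"
    and inj: "inj_on h (box (Complex a c) (Complex b d))"
    and img: "h ` box (Complex a c) (Complex b d) \<subseteq> ball w R" and R: "R \<ge> 0"
  shows "(\<lambda>x. integral {c..d} (\<lambda>y. (norm (deriv h (Complex x y)))\<^sup>2)) integrable_on {a..b}"
    and "integral {a..b} (\<lambda>x. integral {c..d} (\<lambda>y. (norm (deriv h (Complex x y)))\<^sup>2)) \<le> pi * R\<^sup>2"
proof -
  define \<psi> :: "real^2 \<Rightarrow> complex" where "\<psi> v = Complex (v$1) (v$2)" for v
  define \<phi> :: "complex \<Rightarrow> real^2" where "\<phi> z = vector [Re z, Im z]" for z
  define D where "D z = (norm (deriv h z))\<^sup>2" for z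
  define S :: "(real^2) set" where "S = box (vector [a,c]) (vector [b,d])"
  define S' :: "(real^2) set" where "S' = cbox (vector [a,c]) (vector [b,d])"
  have \<phi>\<psi>: "\<phi> (\<psi> v) = v" "\<psi> (\<phi> z) = z" for v z
    by (auto simp: \<phi>_def \<psi>_def vec_eq_iff forall_2 complex_eq_iff)
  have \<psi>S: "\<psi> v \<in> box (Complex a c) (Complex b d)" if "v \<in> S" for v
    using that by (auto simp: S_def \<psi>_def in_box_complex_iff mem_box_cart forall_2)
  have \<psi>S': "\<psi> v \<in> cbox (Complex a c) (Complex b d)" if "v \<in> S'" for v
    using that by (auto simp: S'_def \<psi>_def in_cbox_complex_iff mem_box_cart forall_2)
  have lin\<psi>: "bounded_linear \<psi>"
    unfolding linear_conv_bounded_linear[symmetric]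
    by (rule linearI) (auto simp: \<psi>_def complex_eq_iff)
  have lin\<phi>: "bounded_linear \<phi>"
    unfolding linear_conv_bounded_linear[symmetric]
    by (rule linearI) (auto simp: \<phi>_def vec_eq_iff forall_2)
  have norm\<phi>: "norm (\<phi> z) = norm z" for z
    by (simp add: \<phi>_def norm_vec_def L2_set_def sum_2 cmod_def)
  define K where "K = (\<lambda>v. \<phi> (h (\<psi> v)))"
  define K' where "K' = (\<lambda>v w. \<phi> (deriv h (\<psi> v) * \<psi> w))"
  have der: "(K has_derivative K' v) (at v within S)" if "v \<in> S" for v
  proof -
    have "\<psi> v \<in> U" using \<psi>S[OF that] holo(3) box_subset_cbox by blast
    then have "(h has_field_derivative deriv h (\<psi> v)) (at (\<psi> v))"
      using holo by (simp add: holomorphic_derivI)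
    then have 1: "(h has_derivative (\<lambda>w. deriv h (\<psi> v) * w)) (at (\<psi> v))"
      by (simp add: has_field_derivative_def)
    have 2: "(\<psi> has_derivative \<psi>) (at v within S)"
      using lin\<psi> by (rule bounded_linear_imp_has_derivative)
    have "((\<lambda>v. h (\<psi> v)) has_derivative (\<lambda>w. deriv h (\<psi> v) * \<psi> w)) (at v within S)"
      using has_derivative_compose[OF 2 1] .
    from bounded_linear.has_derivative[OF lin\<phi> this] show ?thesis
      by (simp add: K_def K'_def)
  qed
  have det: "\<bar>det (matrix (K' v))\<bar> = D (\<psi> v)" for v
  proof -
    have e: "\<psi> (axis 1 1) = 1" "\<psi> (axis 2 1) = \<i>"
      by (auto simp: \<psi>_def complex_eq_iff axis_def)
    have "det (matrix (K' v)) = (Re (deriv h (\<psi> v)))\<^sup>2 + (Im (deriv h (\<psi> v)))\<^sup>2"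
      by (simp add: det_2 matrix_def K'_def e \<phi>_def power2_eq_square)
    then show ?thesis by (simp add: D_def cmod_def)
  qed
  have injK: "inj_on K S"
  proof (rule inj_onI)
    fix u v assume "u \<in> S" "v \<in> S" "K u = K v"
    then have "h (\<psi> u) = h (\<psi> v)" unfolding K_def by (metis \<phi>\<psi>(2))
    then have "\<psi> u = \<psi> v" using inj \<psi>S \<open>u \<in> S\<close> \<open>v \<in> S\<close> by (meson inj_onD)
    then show "u = v" by (metis \<phi>\<psi>(1))
  qed
  have contD: "continuous_on U D"
    unfolding D_def using holo
    by (intro continuous_intros holomorphic_on_imp_continuous_on holomorphic_deriv) auto
  have "continuous_on S' (\<lambda>v. D (\<psi> v))"
    by (rule continuous_on_compose2[OF contD])
       (use \<psi>S' holo(3) lin\<psi> in \<open>auto intro: linear_continuous_on\<close>)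
  then have int: "(\<lambda>v. D (\<psi> v)) integrable_on S'"
    unfolding S'_def by (rule integrable_continuous)
  then have int': "(\<lambda>v. \<bar>det (matrix (K' v))\<bar>) integrable_on S"
    unfolding det S_def S'_def by (simp add: integrable_on_open_interval)
  have Sl: "S \<in> sets lebesgue" by (simp add: S_def)
  have Km: "K ` S \<in> lmeasurable"
    using measurable_differentiable_image_eq[OF Sl der injK] int' by blast
  have "integral S (\<lambda>v. D (\<psi> v)) = measure lebesgue (K ` S)"
    using measure_differentiable_image_eq[OF Sl der injK int'] by (simp add: det)
  also have "\<dots> \<le> measure lebesgue (ball (\<phi> w) R)"
  proof (rule measure_mono_fmeasurable)
    show "K ` S \<subseteq> ball (\<phi> w) R"
    proof
      fix y assume "y \<in> K ` S"
      then obtain v where v: "v \<in> S" "y = K v" by blast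
      have "dist (\<phi> w) y = norm (\<phi> (w - h (\<psi> v)))"
        by (simp add: v K_def dist_norm bounded_linear.linear lin\<phi> linear_diff)
      also have "\<dots> < R" using img \<psi>S[OF v(1)] by (auto simp: norm\<phi> dist_norm)
      finally show "y \<in> ball (\<phi> w) R" by simp
    qed
  qed (use Km in \<open>auto simp: fmeasurableD\<close>)
  also have "\<dots> = pi * R\<^sup>2" using circle_area[OF R, of "\<phi> w"] by (simp add: mult.commute)
  finally have le: "integral S (\<lambda>v. D (\<psi> v)) \<le> pi * R\<^sup>2" .
  define g :: "real^2 \<Rightarrow> real \<times> real" where "g v = (v$1, v$2)" for v
  define g' :: "real \<times> real \<Rightarrow> real^2" where "g' q = vector [fst q, snd q]" for q
  define D' where "D' = (\<lambda>q. D (Complex (fst q) (snd q)))"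
  have gg: "g' (g v) = v" "g (g' q) = q" for v q
    by (auto simp: g_def g'_def vec_eq_iff forall_2)
  have gcb: "g ` cbox u v = cbox (g u) (g v)" for u v
  proof -
    have 1: "x \<in> cbox u v \<longleftrightarrow> g x \<in> cbox (g u) (g v)" for x
      by (auto simp: g_def mem_box_cart forall_2)
    show ?thesis
    proof (intro set_eqI iffI)
      fix q assume "q \<in> g ` cbox u v"
      then show "q \<in> cbox (g u) (g v)" using 1 by blast
    next
      fix q assume "q \<in> cbox (g u) (g v)"
      then have "g' q \<in> cbox u v" using 1[of "g' q"] by (simp only: gg)
      then show "q \<in> g ` cbox u v" using gg(2)[of q] by (metis imageI)
    qed
  qed
  have g'cb: "g' ` cbox u v = cbox (g' u) (g' v)" for u v
  proof -
    have "g' ` cbox u v = g' ` g ` cbox (g' u) (g' v)" by (simp only: gcb gg)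
    then show ?thesis by (simp add: image_image gg)
  qed
  have cg: "measure lborel (g ` cbox u v) = measure lborel (cbox u v)" for u v
  proof -
    have "measure lborel (cbox (g u) (g v)) = measure lborel (cbox (u$1) (v$1)) * measure lborel (cbox (u$2) (v$2))"
      by (simp add: g_def content_Pair)
    also have "\<dots> = measure lborel (cbox u v)"
    proof -
      have "cbox u v = {} \<longleftrightarrow> \<not> (u$1 \<le> v$1 \<and> u$2 \<le> v$2)"
        unfolding interval_eq_empty_cart using forall_2[of "\<lambda>i. \<not> v $ i < u $ i"] by auto
      then show ?thesis by (auto simp: content_cbox_if_cart UNIV_2)
    qed
    finally show ?thesis by (simp add: gcb)
  qed
  have Q: "continuous_on (cbox (a,c) (b,d)) D'"
    unfolding D'_def
    by (rule continuous_on_compose2[OF contD])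
       (use holo(3) in \<open>force simp: in_cbox_complex_iff Complex_eq intro!: continuous_intros\<close>)+
  then have "(D' has_integral integral (cbox (a,c) (b,d)) D') (cbox (a,c) (b,d))"
    using integrable_continuous integrable_integral by blast
  then have "((\<lambda>x. D' (g x)) has_integral (1 / 1) *\<^sub>R integral (cbox (a,c) (b,d)) D') (g' ` cbox (a,c) (b,d))"
  proof (rule has_integral_twiddle[rotated -1])
    show "continuous (at x) g" for x
      unfolding g_def by (intro continuous_intros)
    show "\<exists>w z. g ` cbox u v = cbox w z" for u v using gcb by blast
    show "\<exists>w z. g' ` cbox u v = cbox w z" for u v using g'cb by blast
  qed (simp_all add: gg cg)
  moreover have "g' ` cbox (a,c) (b,d) = S'" unfolding g'cb by (simp add: S'_def g'_def)
  moreover have "D' (g v) = D (\<psi> v)" for v by (simp add: D'_def g_def \<psi>_def)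
  ultimately have "integral S' (\<lambda>v. D (\<psi> v)) = integral (cbox (a,c) (b,d)) D'"
    by (simp add: integral_unique)
  also have "\<dots> = integral {a..b} (\<lambda>x. integral {c..d} (\<lambda>y. D (Complex x y)))"
    using integral_prod_continuous[OF Q] by (simp add: D'_def)
  finally show "integral {a..b} (\<lambda>x. integral {c..d} (\<lambda>y. (norm (deriv h (Complex x y)))\<^sup>2)) \<le> pi * R\<^sup>2"
    using le by (simp add: D_def S_def S'_def integral_open_interval)
  have "continuous_on {a..b} (\<lambda>x. integral (cbox c d) (\<lambda>y. D (Complex x y)))"
    by (rule integral_continuous_on_param)
       (use continuous_on_subset[OF Q, of "{a..b} \<times> cbox c d"] in \<open>simp add: D'_def cbox_Pair_eq split_def\<close>)
  then show "(\<lambda>x. integral {c..d} (\<lambda>y. (norm (deriv h (Complex x y)))\<^sup>2)) integrable_on {a..b}"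
    unfolding D_def by (intro integrable_continuous_real) simp
qed

section \<open>Fourier coefficients on a circle\<close>

lemma circle_fourier_coefficient:
  assumes holo: "m holomorphic_on ball 0 1" and t: "0 < t" "t < 1"
  shows "((\<lambda>y. m (of_real t * cis y) * cis (- real k * y)) has_integral
           2 * pi * fps_nth (fps_expansion m 0) k * of_real t ^ k) {0..2*pi}"
proof -
  have "((\<lambda>u. m u / (u - 0) ^ Suc k) has_contour_integral
          (2 * pi * \<i>) / fact k * (deriv ^^ k) m 0) (circlepath 0 t)"
    by (rule Cauchy_has_contour_integral_higher_derivative_circlepath)
       (use t in \<open>auto intro!: holomorphic_on_subset[OF holo] holomorphic_on_imp_continuous_on\<close>)
  then have "((\<lambda>y. m (of_real t * cis y) / (of_real t * cis y) ^ Suc k * of_real t * \<i> * cis y)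
      has_integral (2 * pi * \<i>) / fact k * (deriv ^^ k) m 0) {0..2*pi}"
    by (simp add: circlepath_def has_contour_integral_part_circlepath_iff)
  from has_integral_mult_right[OF this, of "of_real t ^ k / \<i>"]
  have "((\<lambda>y. of_real t ^ k / \<i> * (m (of_real t * cis y) / (of_real t * cis y) ^ Suc k * of_real t * \<i> * cis y))
      has_integral of_real t ^ k / \<i> * ((2 * pi * \<i>) / fact k * (deriv ^^ k) m 0)) {0..2*pi}" .
  moreover have "of_real t ^ k / \<i> * (m (of_real t * cis y) / (of_real t * cis y) ^ Suc k * of_real t * \<i> * cis y)
      = m (of_real t * cis y) * cis (- real k * y)" for y
  proof -
    have "cis (- real k * y) = inverse (cis y ^ k)"
      by (simp only: Complex.DeMoivre cis_inverse mult_minus_left)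
    then show ?thesis using t by (simp add: field_simps power_mult_distrib)
  qed
  ultimately show ?thesis
    by (simp add: fps_expansion_def mult_ac)
qed

text \<open>Bessel's inequality for the two frequencies \<open>0\<close> and \<open>n\<close>: it is the integral of
\<open>\<bar>m - u\<bar>\<^sup>2 \<ge> 0\<close> over the circle, where \<open>u\<close> is the part of \<open>m\<close> with these frequencies.\<close>

lemma circle_bessel_two_terms:
  assumes holo: "m holomorphic_on ball 0 1" and t: "0 < t" "t < 1" and n: "n > 0"
  shows "2 * pi * ((norm (fps_nth (fps_expansion m 0) 0))\<^sup>2
           + (norm (fps_nth (fps_expansion m 0) n))\<^sup>2 * t ^ (2 * n))
         \<le> integral {0..2*pi} (\<lambda>y. (norm (m (of_real t * cis y)))\<^sup>2)"
proof -
  define a where "a = fps_nth (fps_expansion m 0) 0"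
  define b where "b = fps_nth (fps_expansion m 0) n * of_real t ^ n"
  define M where "M y = m (of_real t * cis y)" for y
  have Ma: "(M has_integral 2 * pi * a) {0..2*pi}"
    using circle_fourier_coefficient[OF holo t, of 0] by (simp add: a_def M_def[abs_def])
  have Mb: "((\<lambda>y. M y * cis (- real n * y)) has_integral 2 * pi * b) {0..2*pi}"
    using circle_fourier_coefficient[OF holo t, of n] by (simp add: b_def M_def mult_ac)
  have c: "((\<lambda>y. cis (real n * y)) has_integral 0) {0..2*pi}"
  proof -
    have "((\<lambda>y. (of_real t * cis y) ^ n) has_integral 0) {0..2*pi}"
      using circle_fourier_coefficient[of "\<lambda>z. z ^ n", OF _ t, of 0] n
      by (simp add: fps_expansion_def holomorphic_intros zero_power)
    from has_integral_mult_right[OF this, of "1 / of_real t ^ n"] show ?thesis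
      using t by (simp add: power_mult_distrib Complex.DeMoivre)
  qed
  \<comment> \<open>\<open>L = 2 Re (cnj u * M) - \<bar>u\<bar>\<^sup>2\<close> for \<open>u y = a + b * cis (n * y)\<close>, expanded into terms that are integrated one by one\<close>
  define L where "L y = 2 * Re (cnj a * M y + cnj b * (M y * cis (- real n * y)))
      - (norm a)\<^sup>2 - (norm b)\<^sup>2 - 2 * Re (cnj a * b * cis (real n * y))" for y
  have "((\<lambda>y. 2 * Re (cnj a * M y + cnj b * (M y * cis (- real n * y)))
      - ((norm a)\<^sup>2 + (norm b)\<^sup>2) - 2 * Re (cnj a * b * cis (real n * y))) has_integral
      2 * Re (cnj a * (2 * pi * a) + cnj b * (2 * pi * b))
      - (2 * pi - 0) *\<^sub>R ((norm a)\<^sup>2 + (norm b)\<^sup>2) - 2 * Re (cnj a * b * 0)) {0..2*pi}"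
    using has_integral_const_real[of "(norm a)\<^sup>2 + (norm b)\<^sup>2" 0 "2*pi"]
    by (intro has_integral_diff has_integral_mult_right has_integral_Re has_integral_add Ma Mb c)
       simp_all
  moreover have "2 * Re (cnj a * (2 * pi * a) + cnj b * (2 * pi * b))
      - (2 * pi - 0) *\<^sub>R ((norm a)\<^sup>2 + (norm b)\<^sup>2) - 2 * Re (cnj a * b * 0)
      = 2 * pi * ((norm a)\<^sup>2 + (norm b)\<^sup>2)"
    unfolding cmod_power2 by (simp add: power2_eq_square algebra_simps)
  ultimately have Lint: "(L has_integral 2 * pi * ((norm a)\<^sup>2 + (norm b)\<^sup>2)) {0..2*pi}"
    by (simp add: L_def[abs_def] algebra_simps)
  have L: "L y \<le> (norm (M y))\<^sup>2" for y
  proof -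
    define e where "e = cis (real n * y)"
    have e: "cis (- real n * y) = cnj e" "cnj e * e = 1"
      by (simp_all add: e_def cis_cnj cis_mult)
    have "(norm (M y))\<^sup>2 - L y = (norm (M y - (a + b * e)))\<^sup>2
        + (1 - Re (cnj e * e)) * (norm b)\<^sup>2"
      unfolding L_def e(1) e_def[symmetric]
      unfolding cmod_power2 by (simp add: power2_eq_square algebra_simps)
    then have "(norm (M y))\<^sup>2 - L y = (norm (M y - (a + b * e)))\<^sup>2" by (simp add: e(2))
    then show ?thesis using zero_le_power2[of "norm (M y - (a + b * e))"] by linarith
  qed
  have "continuous_on {0..2*pi} (\<lambda>y. (norm (M y))\<^sup>2)"
    unfolding M_def using t
    by (intro continuous_intros continuous_on_compose2[OF holomorphic_on_imp_continuous_on[OF holo]])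
       (auto simp: norm_mult)
  then have "(\<lambda>y. (norm (M y))\<^sup>2) integrable_on {0..2*pi}"
    by (rule integrable_continuous_real)
  from has_integral_le[OF Lint integrable_integral[OF this]] L
  show ?thesis
    using t by (simp add: a_def b_def M_def norm_mult norm_power power_mult_distrib power_mult power2_eq_square mult_ac)
qed

section \<open>An area theorem with defect\<close>

lemma quadratic_remainder_bound:
  fixes p :: "complex \<Rightarrow> complex"
  assumes p: "p has_fps_expansion F" and C: "norm (fps_nth F 2) < C"
  shows "\<forall>\<^sub>F z in nhds 0. norm (p z - fps_nth F 0 - fps_nth F 1 * z) \<le> C * (norm z)\<^sup>2"
proof -
  define Q where "Q = eval_fps (fps_shift 2 F)"
  have rad: "fps_conv_radius (fps_shift 2 F) > 0"
    using p by (simp add: has_fps_expansion_def)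
  have Qe: "Q has_fps_expansion fps_shift 2 F"
    using rad by (simp add: Q_def has_fps_expansion_def)
  have "(\<lambda>z. fps_nth F 0 + fps_nth F 1 * z + z ^ 2 * Q z) has_fps_expansion
        fps_const (fps_nth F 0) + fps_const (fps_nth F 1) * fps_X + fps_X ^ 2 * fps_shift 2 F"
    by (intro fps_expansion_intros Qe)
  also have "fps_const (fps_nth F 0) + fps_const (fps_nth F 1) * fps_X + fps_X ^ 2 * fps_shift 2 F = F"
  proof (rule fps_ext)
    fix n :: nat
    have "n = 0 \<or> n = 1 \<or> n \<ge> 2" by linarith
    then show "fps_nth (fps_const (fps_nth F 0) + fps_const (fps_nth F 1) * fps_X
        + fps_X ^ 2 * fps_shift 2 F) n = fps_nth F n"
      by (auto simp: fps_X_power_mult_nth simp flip: One_nat_def dest!: le_Suc_ex)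
  qed
  finally have "\<forall>\<^sub>F z in nhds 0. eval_fps F z = fps_nth F 0 + fps_nth F 1 * z + z ^ 2 * Q z"
    by (simp add: has_fps_expansion_def)
  moreover have "\<forall>\<^sub>F z in nhds 0. eval_fps F z = p z"
    using p by (simp add: has_fps_expansion_def)
  moreover have "\<forall>\<^sub>F z in nhds 0. norm (Q z) < C"
  proof -
    have "isCont Q 0" using has_fps_expansion_imp_continuous[OF Qe, of UNIV] by simp
    then have "((\<lambda>z. norm (Q z)) \<longlongrightarrow> norm (Q 0)) (nhds 0)"
      by (intro tendsto_norm) (simp add: isCont_def tendsto_at_iff_tendsto_nhds)
    moreover have "norm (Q 0) < C" using C by (simp add: Q_def eval_fps_at_0 flip: numeral_2_eq_2)
    ultimately show ?thesis by (rule order_tendstoD)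
  qed
  ultimately show ?thesis
  proof eventually_elim
    case (elim z)
    then have "p z - fps_nth F 0 - fps_nth F 1 * z = z ^ 2 * Q z" by simp
    then show ?case using elim(3)
      by (simp add: norm_mult norm_power mult.commute[of C] mult_left_mono)
  qed
qed

text \<open>Here \<open>p z / z\<close> stands for \<open>1 / f z\<close>. If \<open>w\<close> were outside the disc, then the equation
\<open>p z / z = w\<close>, rewritten as \<open>z = (p z - c z) / (w - c)\<close>, would have a solution with
\<open>\<bar>z\<bar> \<le> \<epsilon>\<close> by Brouwer's fixed point theorem. When \<open>p z / z\<close> is injective, this applies to
each value \<open>w\<close> that it takes at a point with \<open>\<bar>z\<bar> > \<epsilon>\<close>.\<close>

lemma image_outside_small_disc:
  fixes p :: "complex \<Rightarrow> complex"
  assumes cont: "continuous_on (cball 0 \<epsilon>) p" and p0: "p 0 \<noteq> 0"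
    and rem: "\<And>z::complex. norm z \<le> \<epsilon> \<Longrightarrow> norm (p z - c * z) \<le> \<epsilon> * R"
    and inj: "\<And>z::complex. 0 < norm z \<Longrightarrow> norm z \<le> \<epsilon> \<Longrightarrow> p z / z \<noteq> w"
    and eps: "\<epsilon> > 0" "R > 0"
  shows "w \<in> ball c R"
proof (rule ccontr)
  assume "w \<notin> ball c R"
  then have w: "R \<le> norm (w - c)" by (simp add: dist_norm norm_minus_commute)
  then have w0: "w - c \<noteq> 0" using eps by auto
  define T where "T z = (p z - c * z) / (w - c)" for z
  obtain z where z: "z \<in> cball 0 \<epsilon>" "T z = z"
  proof (rule brouwer_ball[OF eps(1), of 0 T])
    show "continuous_on (cball 0 \<epsilon>) T"
      unfolding T_def using w0 by (intro continuous_intros cont) auto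
    show "T \<in> cball 0 \<epsilon> \<rightarrow> cball 0 \<epsilon>"
    proof
      fix z :: complex assume "z \<in> cball 0 \<epsilon>"
      then have "norm (p z - c * z) \<le> \<epsilon> * norm (w - c)"
        using rem[of z] mult_left_mono[OF w, of \<epsilon>] eps by (simp add: order.trans)
      then show "T z \<in> cball 0 \<epsilon>"
        using w0 by (simp add: T_def norm_divide pos_divide_le_eq)
    qed
  qed
  have "p z = z * w" using z(2) w0 by (simp add: T_def field_simps)
  moreover from this have "z \<noteq> 0" using p0 by auto
  ultimately show False using inj[of z] z(1) by simp
qed

text \<open>The composition of \<open>p z / z\<close> with the exponential is injective on the rectangle
\<open>ln \<epsilon> < Re \<zeta> < ln \<rho>\<close>, \<open>0 < Im \<zeta> < 2 \<pi>\<close>, so the area of the image of the annulus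
\<open>\<epsilon> < \<bar>z\<bar> < \<rho>\<close> is an iterated integral over \<open>Re \<zeta>\<close> and \<open>Im \<zeta>\<close>, which play the part of
polar coordinates. The derivative
of the composition is \<open>m z / z\<close> with \<open>m z = z p' z - p z\<close> and \<open>z = exp \<zeta>\<close>. The Taylor
coefficients of \<open>m\<close> are \<open>(n - 1) c\<^sub>n\<close>; those of index \<open>0\<close> and \<open>k + 1\<close> enter
Bessel's inequality on each circle, and integration over the radii gives the left-hand side.\<close>

lemma annulus_area_le:
  fixes p :: "complex \<Rightarrow> complex"
  assumes holo: "p holomorphic_on ball 0 1" and p0: "p 0 = 1"
    and inj: "inj_on (\<lambda>z. p z / z) (ball 0 1 - {0})"
    and k: "k > 0" and eps: "0 < \<epsilon>" "\<epsilon> < \<rho>" "\<rho> < 1" and R: "R \<ge> 0"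
    and img: "\<And>z. \<epsilon> < norm z \<Longrightarrow> norm z < 1 \<Longrightarrow> p z / z \<in> ball c R"
  shows "(1 / \<epsilon>\<^sup>2 - 1 / \<rho>\<^sup>2)
           + real k * (norm (fps_nth (fps_expansion p 0) (Suc k)))\<^sup>2 * (\<rho> ^ (2 * k) - \<epsilon> ^ (2 * k)) \<le> R\<^sup>2"
proof -
  define m where "m z = z * deriv p z - p z" for z
  define h where "h \<zeta> = p (exp \<zeta>) / exp \<zeta>" for \<zeta>
  define U where "U = {\<zeta>::complex. Re \<zeta> < 0}"
  define N where "N = (norm (fps_nth (fps_expansion p 0) (Suc k)))\<^sup>2"
  have U: "open U" unfolding U_def by (rule open_halfspace_Re_lt)
  have expU: "exp \<zeta> \<in> ball 0 1" if "\<zeta> \<in> U" for \<zeta>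
    using that by (simp add: U_def)
  have holo_m: "m holomorphic_on ball 0 1"
    unfolding m_def by (intro holomorphic_intros holo holomorphic_deriv) auto
  have "p has_fps_expansion fps_expansion p 0"
    by (rule has_fps_expansion_fps_expansion[OF _ _ holo]) auto
  then have "m has_fps_expansion fps_X * fps_deriv (fps_expansion p 0) - fps_expansion p 0"
    unfolding m_def by (intro fps_expansion_intros)
  then have m_exp: "fps_expansion m 0 = fps_X * fps_deriv (fps_expansion p 0) - fps_expansion p 0"
    by (rule fps_expansion_eqI)
  have m0: "norm (fps_nth (fps_expansion m 0) 0) = 1"
    by (simp add: fps_expansion_def m_def p0)
  have mk: "(norm (fps_nth (fps_expansion m 0) (Suc k)))\<^sup>2 = real k ^ 2 * N"
  proof -
    have "fps_nth (fps_expansion m 0) (Suc k) = of_nat k * fps_nth (fps_expansion p 0) (Suc k)"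
      by (simp add: m_exp algebra_simps)
    then show ?thesis by (simp add: N_def norm_mult power_mult_distrib)
  qed
  have deriv_h: "(h has_field_derivative m (exp \<zeta>) / exp \<zeta>) (at \<zeta>)" if "\<zeta> \<in> U" for \<zeta>
  proof -
    have "(p has_field_derivative deriv p (exp \<zeta>)) (at (exp \<zeta>))"
      using holo expU[OF that] by (simp add: holomorphic_derivI)
    then have "((\<lambda>\<zeta>. p (exp \<zeta>)) has_field_derivative deriv p (exp \<zeta>) * exp \<zeta>) (at \<zeta>)"
      by (intro DERIV_chain2 DERIV_exp)
    then have "(h has_field_derivative (deriv p (exp \<zeta>) * exp \<zeta> * exp \<zeta> - p (exp \<zeta>) * exp \<zeta>)
        / (exp \<zeta> * exp \<zeta>)) (at \<zeta>)"
      unfolding h_def by (intro DERIV_divide DERIV_exp) auto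
    also have "(deriv p (exp \<zeta>) * exp \<zeta> * exp \<zeta> - p (exp \<zeta>) * exp \<zeta>) / (exp \<zeta> * exp \<zeta>)
        = m (exp \<zeta>) / exp \<zeta>"
      by (simp add: m_def divide_simps) (simp add: algebra_simps)
    finally show ?thesis .
  qed
  have holo_h: "h holomorphic_on U"
    using deriv_h U by (meson holomorphic_on_open)
  define a where "a = ln \<epsilon>"
  define b where "b = ln \<rho>"
  have ab: "a \<le> b" "b < 0" "exp a = \<epsilon>" "exp b = \<rho>" using eps by (simp_all add: a_def b_def)
  let ?box = "box (Complex a 0) (Complex b (2*pi))"
  have sub: "cbox (Complex a 0) (Complex b (2*pi)) \<subseteq> U"
    using ab by (auto simp: U_def in_cbox_complex_iff)
  have inj_h: "inj_on h ?box"
  proof (rule inj_onI)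
    fix x y assume xy: "x \<in> ?box" "y \<in> ?box" "h x = h y"
    then have "x \<in> U" "y \<in> U" using sub box_subset_cbox by blast+
    then have "exp x = exp y"
      using inj_onD[OF inj, of "exp x" "exp y"] xy(3) expU by (simp add: h_def)
    moreover have "\<bar>Im x - Im y\<bar> < 2 * pi" using xy(1,2) by (auto simp: in_box_complex_iff)
    ultimately show "x = y" using exp_complex_eqI[of x y] by blast
  qed
  have img_h: "h ` ?box \<subseteq> ball c R"
  proof
    fix w assume "w \<in> h ` ?box"
    then obtain \<zeta> where z: "\<zeta> \<in> ?box" "w = h \<zeta>" by blast
    then have "a < Re \<zeta>" "Re \<zeta> < 0" using ab by (auto simp: in_box_complex_iff)
    then have "\<epsilon> < norm (exp \<zeta>)" "norm (exp \<zeta>) < 1" unfolding ab(3)[symmetric] by simp_all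
    then show "w \<in> ball c R" using img[of "exp \<zeta>"] z(2) by (simp add: h_def)
  qed
  have exp_2: "exp (- 2 * x) = 1 / (exp x)\<^sup>2" for x :: real
  proof -
    have "exp (- (2 * x)) = inverse ((exp x)\<^sup>2)" by (simp only: exp_minus exp_double)
    then show ?thesis by (simp only: inverse_eq_divide mult_minus_left)
  qed
  have exp_2k: "exp (2 * real k * x) = exp x ^ (2 * k)" for x :: real
    using exp_of_nat_mult[of "2 * k" x] by simp
  define I where "I x = integral {0..2*pi} (\<lambda>y. (norm (deriv h (Complex x y)))\<^sup>2)" for x
  note area = area_injective_holomorphic_le[OF holo_h U sub inj_h img_h R, folded I_def]
  define l where "l x = 2 * pi * (exp (- 2 * x) + real k ^ 2 * N * exp (2 * real k * x))" for x
  have lI: "l x \<le> I x" if x: "x \<in> {a..b}" for x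
  proof -
    have x0: "x < 0" using x ab by simp
    have "I x = integral {0..2*pi} (\<lambda>y. exp (- 2 * x) * (norm (m (of_real (exp x) * cis y)))\<^sup>2)"
      unfolding I_def
    proof (rule integral_cong)
      fix y
      have "deriv h (Complex x y) = m (exp (Complex x y)) / exp (Complex x y)"
        by (rule DERIV_imp_deriv[OF deriv_h]) (simp add: U_def x0)
      also have "exp (Complex x y) = of_real (exp x) * cis y"
        using exp_eq_polar[of "Complex x y"] by (simp only: complex.sel)
      finally show "(norm (deriv h (Complex x y)))\<^sup>2
          = exp (- 2 * x) * (norm (m (of_real (exp x) * cis y)))\<^sup>2"
        unfolding exp_2 by (simp only: norm_divide norm_mult norm_of_real abs_exp_cancel norm_cis power_divide mult_1_right mult_1_left times_divide_eq_left)
    qed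
    also have "\<dots> = exp (- 2 * x) * integral {0..2*pi} (\<lambda>y. (norm (m (of_real (exp x) * cis y)))\<^sup>2)"
      by simp
    also have "\<dots> \<ge> exp (- 2 * x) * (2 * pi * (1 + real k ^ 2 * N * exp x ^ (2 * Suc k)))"
      using mult_left_mono[OF circle_bessel_two_terms[OF holo_m, of "exp x" "Suc k", unfolded m0 mk], of "exp (- 2 * x)"] x0
      by (simp only: exp_gt_zero exp_ge_zero exp_less_one_iff zero_less_Suc power_one simp_thms)
    also have "exp (- 2 * x) * (2 * pi * (1 + real k ^ 2 * N * exp x ^ (2 * Suc k))) = l x"
    proof -
      define E where "E = exp x"
      have "E > 0" by (simp add: E_def)
      have "E ^ (2 * Suc k) = E\<^sup>2 * E ^ (2 * k)" by (simp flip: power_add)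
      then have "1 / E\<^sup>2 * (2 * pi * (1 + real k ^ 2 * N * E ^ (2 * Suc k)))
          = 2 * pi * (1 / E\<^sup>2 + real k ^ 2 * N * E ^ (2 * k))"
        using \<open>E > 0\<close> by (simp only:) (simp add: distrib_left)
      then show ?thesis unfolding l_def exp_2 exp_2k E_def .
    qed
    finally show ?thesis .
  qed
  \<comment> \<open>an antiderivative of \<open>l\<close>\<close>
  define L where "L x = pi * (- exp (- 2 * x) + real k * N * exp (2 * real k * x))" for x
  have lL: "(l has_integral L b - L a) {a..b}"
  proof (rule fundamental_theorem_of_calculus[OF ab(1)])
    fix x
    have "(L has_real_derivative pi * (- (exp (- 2 * x) * - 2)
        + real k * N * (exp (2 * real k * x) * (2 * real k)))) (at x within {a..b})"
      unfolding L_def by (auto intro!: derivative_eq_intros)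
    also have "pi * (- (exp (- 2 * x) * - 2) + real k * N * (exp (2 * real k * x) * (2 * real k))) = l x"
      by (simp add: l_def power2_eq_square distrib_left mult_ac)
    finally show "(L has_vector_derivative l x) (at x within {a..b})"
      by (simp only: has_real_derivative_iff_has_vector_derivative)
  qed
  have "L b - L a \<le> integral {a..b} I"
    using has_integral_le[OF lL integrable_integral[OF area(1)]] lI by blast
  also have "\<dots> \<le> pi * R\<^sup>2" by (rule area(2))
  finally have "L b - L a \<le> pi * R\<^sup>2" .
  moreover have "L b - L a = pi * ((1 / \<epsilon>\<^sup>2 - 1 / \<rho>\<^sup>2) + real k * N * (\<rho> ^ (2 * k) - \<epsilon> ^ (2 * k)))"
    unfolding L_def exp_2 exp_2k ab(3,4) by (simp add: algebra_simps)
  ultimately show ?thesis by (simp add: N_def)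
qed

text \<open>The radius \<open>1 / \<epsilon> + C \<epsilon>\<close> has square \<open>1 / \<epsilon>\<^sup>2 + 2 C + C\<^sup>2 \<epsilon>\<^sup>2\<close>, whose first
term cancels against the area integral; then \<open>\<epsilon> \<rightarrow> 0\<close>, \<open>\<rho> \<rightarrow> 1\<close> and \<open>C \<rightarrow> \<bar>c\<^sub>2\<bar>\<close>. Gronwall's
theorem has the sharp bound \<open>1\<close>, but a bound in terms of \<open>\<bar>c\<^sub>2\<bar>\<close> suffices because the case
\<open>k = 1\<close> bounds \<open>\<bar>c\<^sub>2\<bar>\<close> in turn.\<close>

lemma area_theorem_with_defect:
  fixes p :: "complex \<Rightarrow> complex"
  assumes holo: "p holomorphic_on ball 0 1" and p0: "p 0 = 1"
    and inj: "inj_on (\<lambda>z. p z / z) (ball 0 1 - {0})" and k: "k > 0"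
  shows "real k * (norm (fps_nth (fps_expansion p 0) (Suc k)))\<^sup>2
           \<le> 1 + 2 * norm (fps_nth (fps_expansion p 0) 2)"
proof -
  define F where "F = fps_expansion p 0"
  define N where "N = real k * (norm (fps_nth F (Suc k)))\<^sup>2"
  have pF: "p has_fps_expansion F"
    unfolding F_def by (rule has_fps_expansion_fps_expansion[OF _ _ holo]) auto
  have F0: "fps_nth F 0 = 1" by (simp add: F_def fps_expansion_def p0)
  have main: "N \<le> 1 + 2 * C" if C: "norm (fps_nth F 2) < C" for C
  proof -
    have C0: "C > 0" using C by (meson norm_ge_zero order.strict_trans1)
    obtain d where d: "d > 0"
      "\<And>z. norm z < d \<Longrightarrow> norm (p z - 1 - fps_nth F 1 * z) \<le> C * (norm z)\<^sup>2"
      using quadratic_remainder_bound[OF pF C] unfolding eventually_nhds_metric by (auto simp: F0)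
    have ineq: "N * (\<rho> ^ (2 * k) - \<epsilon> ^ (2 * k)) \<le> 1 / \<rho>\<^sup>2 + 2 * C + C\<^sup>2 * \<epsilon>\<^sup>2"
      if eps: "0 < \<epsilon>" "\<epsilon> < \<rho>" "\<rho> < 1" "\<epsilon> < d" for \<epsilon> \<rho>
    proof -
      define R where "R = 1 / \<epsilon> + C * \<epsilon>"
      have R: "R > 0" using eps C0 by (simp add: R_def add_pos_pos)
      have eR: "\<epsilon> * R = 1 + C * \<epsilon>\<^sup>2" using eps by (simp add: R_def field_simps power2_eq_square)
      have img: "p z0 / z0 \<in> ball (fps_nth F 1) R" if z0: "\<epsilon> < norm z0" "norm z0 < 1" for z0
      proof (rule image_outside_small_disc[OF _ _ _ _ eps(1) R])
        show "continuous_on (cball 0 \<epsilon>) p"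
          using eps by (intro holomorphic_on_imp_continuous_on holomorphic_on_subset[OF holo]) auto
        show "p 0 \<noteq> 0" by (simp add: p0)
        show "norm (p z - fps_nth F 1 * z) \<le> \<epsilon> * R" if "norm z \<le> \<epsilon>" for z :: complex
        proof -
          have "norm (p z - fps_nth F 1 * z) \<le> 1 + norm (p z - 1 - fps_nth F 1 * z)"
            using norm_triangle_ineq[of 1 "p z - 1 - fps_nth F 1 * z"] by simp
          also have "\<dots> \<le> 1 + C * (norm z)\<^sup>2" using d(2)[of z] that eps by simp
          also have "\<dots> \<le> 1 + C * \<epsilon>\<^sup>2" using that C0 by (simp add: power_mono)
          finally show ?thesis by (simp add: eR)
        qed
        show "p z / z \<noteq> p z0 / z0" if "0 < norm z" "norm z \<le> \<epsilon>" for z :: complex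
        proof
          assume "p z / z = p z0 / z0"
          moreover have "z \<in> ball 0 1 - {0}" "z0 \<in> ball 0 1 - {0}" using that z0 eps by auto
          ultimately have "z = z0" by (rule inj_onD[OF inj])
          then show False using that z0 by simp
        qed
      qed
      have "(1 / \<epsilon>\<^sup>2 - 1 / \<rho>\<^sup>2) + N * (\<rho> ^ (2 * k) - \<epsilon> ^ (2 * k)) \<le> R\<^sup>2"
        using annulus_area_le[OF holo p0 inj k eps(1,2,3) _ img] R unfolding N_def F_def by simp
      moreover have "R\<^sup>2 = 1 / \<epsilon>\<^sup>2 + 2 * C + C\<^sup>2 * \<epsilon>\<^sup>2"
        using eps by (simp add: R_def power2_sum power_mult_distrib power_divide)
      ultimately show ?thesis by simp
    qed
    have ineq': "N * \<rho> ^ (2 * k) \<le> 1 / \<rho>\<^sup>2 + 2 * C" if \<rho>: "0 < \<rho>" "\<rho> < 1" for \<rho>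
    proof (rule tendsto_le)
      show "((\<lambda>\<epsilon>. N * (\<rho> ^ (2 * k) - \<epsilon> ^ (2 * k))) \<longlongrightarrow> N * \<rho> ^ (2 * k)) (at_right 0)"
        using k by (auto intro!: tendsto_eq_intros)
      show "((\<lambda>\<epsilon>. 1 / \<rho>\<^sup>2 + 2 * C + C\<^sup>2 * \<epsilon>\<^sup>2) \<longlongrightarrow> 1 / \<rho>\<^sup>2 + 2 * C) (at_right 0)"
        by (auto intro!: tendsto_eq_intros)
      show "\<forall>\<^sub>F \<epsilon> in at_right 0. N * (\<rho> ^ (2 * k) - \<epsilon> ^ (2 * k)) \<le> 1 / \<rho>\<^sup>2 + 2 * C + C\<^sup>2 * \<epsilon>\<^sup>2"
        unfolding eventually_at_right_field
      proof (intro exI[of _ "min \<rho> d"] conjI allI impI)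
        show "0 < min \<rho> d" using \<rho> d(1) by simp
        show "N * (\<rho> ^ (2 * k) - \<epsilon> ^ (2 * k)) \<le> 1 / \<rho>\<^sup>2 + 2 * C + C\<^sup>2 * \<epsilon>\<^sup>2"
          if "0 < \<epsilon>" "\<epsilon> < min \<rho> d" for \<epsilon>
          using ineq[of \<epsilon> \<rho>] that \<rho>(2) by simp
      qed
    qed simp
    show "N \<le> 1 + 2 * C"
    proof (rule tendsto_le)
      show "((\<lambda>\<rho>. N * \<rho> ^ (2 * k)) \<longlongrightarrow> N) (at_left 1)"
        by (auto intro!: tendsto_eq_intros)
      show "((\<lambda>\<rho>. 1 / \<rho>\<^sup>2 + 2 * C) \<longlongrightarrow> 1 + 2 * C) (at_left 1)"
        by (auto intro!: tendsto_eq_intros)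
      show "\<forall>\<^sub>F \<rho> in at_left 1. N * \<rho> ^ (2 * k) \<le> 1 / \<rho>\<^sup>2 + 2 * C"
        unfolding eventually_at_left_field using ineq' by (intro exI[of _ 0]) simp
    qed simp
  qed
  have "N \<le> 1 + 2 * norm (fps_nth F 2)"
  proof (rule field_le_epsilon)
    fix e :: real assume "e > 0"
    then show "N \<le> 1 + 2 * norm (fps_nth F 2) + e"
      using main[of "norm (fps_nth F 2) + e / 2"] by (simp add: field_simps)
  qed
  then show ?thesis by (simp add: N_def F_def)
qed

lemma reciprocal_coefficient_decay:
  fixes p :: "complex \<Rightarrow> complex"
  assumes holo: "p holomorphic_on ball 0 1" and p0: "p 0 = 1"
    and inj: "inj_on (\<lambda>z. p z / z) (ball 0 1 - {0})" and k: "k > 0"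
  shows "real k * (norm (fps_nth (fps_expansion p 0) (Suc k)))\<^sup>2 \<le> 6"
proof -
  define x where "x = norm (fps_nth (fps_expansion p 0) 2)"
  have "x\<^sup>2 \<le> 1 + 2 * x"
    using area_theorem_with_defect[OF holo p0 inj, of 1] by (simp add: x_def numeral_2_eq_2)
  \<comment> \<open>this gives \<open>x \<le> 1 + sqrt 2\<close>; rounding up to \<open>5/2\<close> keeps the constants rational\<close>
  then have "(x - 1)\<^sup>2 \<le> (3/2)\<^sup>2" by (simp add: power2_eq_square algebra_simps)
  then have "x - 1 \<le> 3/2" by (rule power2_le_imp_le) simp
  then show ?thesis using area_theorem_with_defect[OF holo p0 inj k] by (simp add: x_def)
qed

section \<open>Coefficients of the reciprocal of a univalent function\<close>

text \<open>If \<open>\<bar>c\<^sub>1\<bar>\<close> were large, then the linear term would dominate on the circle \<open>\<bar>z\<bar> = 1/2\<close>, so that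
\<open>\<bar>1 / p\<bar> < 1\<close> there while \<open>1 / p 0 = 1\<close>, against the maximum modulus principle.\<close>

lemma first_coefficient_bound:
  fixes p :: "complex \<Rightarrow> complex"
  assumes holo: "p holomorphic_on ball 0 1" and p0: "p 0 = 1"
    and nz: "\<And>z. z \<in> ball 0 1 \<Longrightarrow> p z \<noteq> 0"
    and coeffs: "\<And>n. norm (fps_nth (fps_expansion p 0) (n + 2)) \<le> 5/2"
  shows "norm (fps_nth (fps_expansion p 0) 1) \<le> 7"
proof (rule ccontr)
  define a where "a n = fps_nth (fps_expansion p 0) n" for n
  assume "\<not> norm (fps_nth (fps_expansion p 0) 1) \<le> 7"
  then have a1: "norm (a 1) > 7" by (simp add: a_def)
  have a0: "a 0 = 1" by (simp add: a_def fps_expansion_def p0)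
  \<comment> \<open>on the circle \<open>\<bar>z\<bar> = 1/2\<close> the linear term exceeds \<open>7/2\<close>, the constant term is \<open>1\<close> and
    the tail is at most \<open>5/4\<close>\<close>
  have large: "norm (p z) \<ge> 5/4" if z: "norm z = 1/2" for z
  proof -
    have "(\<lambda>n. a n * z ^ n) sums p z"
      using holomorphic_power_series[OF holo, of z] z by (simp add: a_def fps_expansion_def)
    then have s: "(\<lambda>n. a (n + 2) * z ^ (n + 2)) sums (p z - (1 + a 1 * z))"
      using sums_iff_shift'[of "\<lambda>n. a n * z ^ n" 2] by (simp add: a0 eval_nat_numeral)
    have g: "(\<lambda>n. 5/8 * (1/2) ^ n) sums (5/4 :: real)"
      using sums_mult[OF geometric_sums[of "1/2::real"], of "5/8"] by simp
    have "norm (p z - (1 + a 1 * z)) \<le> 5/4"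
    proof -
      have le: "norm (a (n + 2) * z ^ (n + 2)) \<le> 5/8 * (1/2) ^ n" for n
      proof -
        have "norm (a (n + 2) * z ^ (n + 2)) = norm (a (n + 2)) * (1/2) ^ n / 4"
          by (simp add: norm_mult norm_power z power_add)
        also have "\<dots> \<le> 5/2 * (1/2) ^ n / 4"
          using coeffs[of n] by (intro divide_right_mono mult_right_mono) (auto simp: a_def)
        finally show ?thesis by simp
      qed
      show ?thesis
        using norm_suminf_le[OF le sums_summable[OF g]] sums_unique[OF s] sums_unique[OF g] by simp
    qed
    moreover have "norm (a 1 * z) \<ge> 7/2" using a1 by (simp only: norm_mult z)
    moreover have "norm (a 1 * z) \<le> norm (p z) + norm (p z - (1 + a 1 * z)) + 1"
      using norm_triangle_ineq4[of "p z" "p z - (1 + a 1 * z)"]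
        norm_triangle_ineq4[of "1 + a 1 * z" 1] by simp
    ultimately show ?thesis by linarith
  qed
  have "norm (1 / p 0) \<le> 4/5"
  proof (rule maximum_modulus_frontier[of "\<lambda>z. 1 / p z" "cball 0 (1/2)"])
    show "(\<lambda>z. 1 / p z) holomorphic_on interior (cball 0 (1/2))"
      using nz by (intro holomorphic_intros holomorphic_on_subset[OF holo]) auto
    show "continuous_on (closure (cball 0 (1/2))) (\<lambda>z. 1 / p z)"
      using nz by (intro continuous_intros holomorphic_on_imp_continuous_on holomorphic_on_subset[OF holo]) auto
    show "norm (1 / p z) \<le> 4/5" if "z \<in> frontier (cball 0 (1/2))" for z
    proof -
      have "5/4 \<le> norm (p z)" using large[of z] that by simp
      moreover from this have "norm (p z) > 0" by linarith
      ultimately show ?thesis by (simp add: norm_divide pos_divide_le_eq)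
    qed
  qed auto
  then show False by (simp add: p0)
qed

lemma class_S_reciprocal:
  assumes f: "f \<in> class_S"
  obtains p where "p holomorphic_on ball 0 1" "p 0 = 1" "\<And>z. z \<in> ball 0 1 \<Longrightarrow> p z \<noteq> 0"
    "inj_on (\<lambda>z. p z / z) (ball 0 1 - {0})"
    "fps_expansion p 0 * fps_expansion f 0 = fps_X"
proof -
  have f': "f holomorphic_on ball 0 1" "f 0 = 0" "deriv f 0 = 1" "inj_on f (ball 0 1)"
    using f by (auto simp: class_S_def class_A_def analytic_imp_holomorphic)
  have fnz: "f z \<noteq> 0" if "z \<in> ball 0 1" "z \<noteq> 0" for z
    using inj_onD[OF f'(4), of z 0] that f'(2) by auto
  define s where "s z = (if z = 0 then 1 else f z / z)" for z
  have s: "s holomorphic_on ball 0 1"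
    by (rule pole_theorem_open_0[OF f'(1), of 0]) (auto simp: s_def f')
  have snz: "s z \<noteq> 0" if "z \<in> ball 0 1" for z
    using fnz[OF that] by (simp add: s_def)
  define p where "p z = 1 / s z" for z
  have p: "p holomorphic_on ball 0 1"
    unfolding p_def using snz by (intro holomorphic_intros s)
  have pf: "p z * f z = z" if "z \<in> ball 0 1" for z
    using fnz[OF that] f'(2) by (cases "z = 0") (auto simp: p_def s_def)
  show ?thesis
  proof (rule that[OF p])
    show "p 0 = 1" by (simp add: p_def s_def)
    show "p z \<noteq> 0" if "z \<in> ball 0 1" for z
      using snz[OF that] by (simp add: p_def)
    show "inj_on (\<lambda>z. p z / z) (ball 0 1 - {0})"
    proof (rule inj_onI)
      fix x y assume xy: "x \<in> ball 0 1 - {0}" "y \<in> ball 0 1 - {0}" "p x / x = p y / y"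
      have "p z / z = 1 / f z" if "z \<in> ball 0 1 - {0}" for z
        using that by (simp add: p_def s_def)
      then have "1 / f x = 1 / f y" using xy by metis
      then have "f x = f y" by (metis div_by_1 divide_divide_eq_right mult_1)
      then show "x = y" using inj_onD[OF f'(4)] xy by blast
    qed
    have "(\<lambda>z. p z * f z) has_fps_expansion fps_expansion p 0 * fps_expansion f 0"
      by (intro has_fps_expansion_mult has_fps_expansion_fps_expansion[of "ball 0 1"] p f') auto
    moreover have "\<forall>\<^sub>F z in nhds 0. p z * f z = z"
      by (rule eventually_mono[OF eventually_nhds_in_open[of "ball 0 1" "0::complex"]]) (auto simp: pf)
    ultimately have "(\<lambda>z. z) has_fps_expansion fps_expansion p 0 * fps_expansion f 0"
      by (rule iffD1[OF has_fps_expansion_cong, rotated -1]) auto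
    then show "fps_expansion p 0 * fps_expansion f 0 = fps_X"
      using fps_expansion_unique_complex has_fps_expansion_fps_X by blast
  qed
qed

lemma class_S_coefficient_data:
  assumes f: "f \<in> class_S"
  obtains P where "P * fps_expansion f 0 = fps_X" "fps_nth P 0 = 1"
    "\<And>k. k > 0 \<Longrightarrow> norm (fps_nth P k) \<le> 7"
    "\<And>k. k > 0 \<Longrightarrow> real k * (norm (fps_nth P (Suc k)))\<^sup>2 \<le> 6"
proof -
  obtain p where p: "p holomorphic_on ball 0 1" "p 0 = 1" "\<And>z. z \<in> ball 0 1 \<Longrightarrow> p z \<noteq> 0"
    "inj_on (\<lambda>z. p z / z) (ball 0 1 - {0})"
    "fps_expansion p 0 * fps_expansion f 0 = fps_X"
    using class_S_reciprocal[OF f] by blast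
  note area = reciprocal_coefficient_decay[OF p(1,2,4)]
  have small: "norm (fps_nth (fps_expansion p 0) (Suc k)) \<le> 5/2" if "k > 0" for k
  proof (rule power2_le_imp_le)
    have "1 * (norm (fps_nth (fps_expansion p 0) (Suc k)))\<^sup>2
        \<le> real k * (norm (fps_nth (fps_expansion p 0) (Suc k)))\<^sup>2"
      using that by (intro mult_right_mono) auto
    then show "(norm (fps_nth (fps_expansion p 0) (Suc k)))\<^sup>2 \<le> (5/2)\<^sup>2"
      using area[OF that] by (simp add: power2_eq_square)
  qed simp
  have first: "norm (fps_nth (fps_expansion p 0) 1) \<le> 7"
    using small[of "Suc n" for n] by (intro first_coefficient_bound p(1-3)) auto
  show ?thesis
  proof (rule that[OF p(5) _ _ area])
    show "fps_nth (fps_expansion p 0) 0 = 1" by (simp add: fps_expansion_def p(2))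
    show "norm (fps_nth (fps_expansion p 0) k) \<le> 7" if "k > 0" for k
      using first small[of "k - 1"] that by (cases "k = 1") auto
  qed
qed

section \<open>Power series and their reciprocals\<close>

text \<open>The recursion for the coefficients of \<open>F\<close> is majorised by the one in which all
\<open>P\<^sub>k\<close> with \<open>k > 0\<close> are \<open>-B\<close>. Its solution is \<open>B (1 + B)\<^bsup>n-1\<^esup>\<close> for \<open>n > 0\<close>; the slightly
larger \<open>(1 + B)\<^sup>n\<close> also covers \<open>n = 0\<close>.\<close>

lemma reciprocal_coefficient_growth:
  fixes P F :: "complex fps"
  assumes PF: "P * F = fps_X" and P0: "fps_nth P 0 = 1"
    and P: "\<And>k. k > 0 \<Longrightarrow> norm (fps_nth P k) \<le> B"
  shows "norm (fps_nth F (Suc n)) \<le> (1 + B) ^ n"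
proof (induction n rule: less_induct)
  case (less n)
  have B: "B \<ge> 0" using P[of 1] by (meson norm_ge_zero order.trans zero_less_one)
  have F0: "fps_nth F 0 = 0"
    using arg_cong[OF PF, of "\<lambda>H. fps_nth H 0"] P0 by simp
  have "(\<Sum>i=0..Suc n. fps_nth P i * fps_nth F (Suc n - i)) = (if n = 0 then 1 else 0)"
    using arg_cong[OF PF, of "\<lambda>H. fps_nth H (Suc n)"] by (simp add: fps_mult_nth)
  then have rec: "fps_nth F (Suc n) = (if n = 0 then 1 else 0)
      - (\<Sum>i<n. fps_nth P (Suc i) * fps_nth F (n - i))"
    by (simp only: sum.atLeast0_atMost_Suc_shift sum.atLeast0_atMost_Suc)
       (cases n; simp add: P0 F0 lessThan_Suc_atMost[symmetric] eq_diff_eq sum.lessThan_Suc atLeast0AtMost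
          add_eq_0_iff add.assoc)
  have "norm (\<Sum>i<n. fps_nth P (Suc i) * fps_nth F (n - i)) \<le> (\<Sum>i<n. B * (1 + B) ^ (n - Suc i))"
  proof (rule sum_norm_le)
    fix i assume "i \<in> {..<n}"
    then have "norm (fps_nth F (n - i)) \<le> (1 + B) ^ (n - Suc i)"
      using less.IH[of "n - Suc i"] by (simp add: Suc_diff_Suc)
    then show "norm (fps_nth P (Suc i) * fps_nth F (n - i)) \<le> B * (1 + B) ^ (n - Suc i)"
      unfolding norm_mult using P[of "Suc i"] B by (intro mult_mono) auto
  qed
  also have "(\<Sum>i<n. B * (1 + B) ^ (n - Suc i)) = B * (\<Sum>i<n. (1 + B) ^ i)"
    by (simp add: sum_distrib_left[symmetric] sum.nat_diff_reindex)
  also have "\<dots> = (1 + B) ^ n - 1"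
    using power_diff_1_eq[of "1 + B" n] by simp
  finally have S: "norm (\<Sum>i<n. fps_nth P (Suc i) * fps_nth F (n - i)) \<le> (1 + B) ^ n - 1" .
  show ?case
    using S norm_triangle_ineq4[of "if n = 0 then 1 else 0 :: complex" "\<Sum>i<n. fps_nth P (Suc i) * fps_nth F (n - i)"]
    by (auto simp: rec split: if_splits)
qed

text \<open>From \<open>(P - Q) F G = X (G - F)\<close> one compares the lowest terms on both sides: \<open>F G\<close> begins
with \<open>X\<^sup>2\<close>, so the lowest term of \<open>P - Q\<close> has index one less than that of \<open>G - F\<close> and
the same coefficient.\<close>

lemma reciprocal_first_difference:
  fixes P Q F G :: "complex fps"
  assumes PF: "P * F = fps_X" and QG: "Q * G = fps_X"
    and P0: "fps_nth P 0 = 1" and Q0: "fps_nth Q 0 = 1" and ne: "F \<noteq> G"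
  shows "fps_nth (P - Q) (subdegree (F - G) - 1) = - fps_nth (F - G) (subdegree (F - G))"
    and "subdegree (F - G) \<ge> 2"
proof -
  have unit: "subdegree H = 1 \<and> fps_nth H 1 = 1" if H: "R * H = fps_X" "fps_nth R 0 = 1" for R H :: "complex fps"
  proof -
    have "R \<noteq> 0" "H \<noteq> 0" using H by auto
    moreover have "subdegree R = 0" using H(2) by (simp add: subdegree_eq_0_iff)
    ultimately have "subdegree H = 1" using subdegree_mult[of R H] H(1) by simp
    then have "fps_nth (R * H) 1 = fps_nth H 1"
      using nth_subdegree_mult[of R H] H(2) \<open>subdegree R = 0\<close> by simp
    then show ?thesis using \<open>subdegree H = 1\<close> H(1) by simp
  qed
  note F = unit[OF PF P0] and G = unit[OF QG Q0]
  have eq: "(P - Q) * (F * G) = - (fps_X * (F - G))"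
  proof -
    have "(P - Q) * (F * G) = (P * F) * G - (Q * G) * F" by (simp only: algebra_simps)
    also have "\<dots> = - (fps_X * (F - G))" unfolding PF QG by (simp add: right_diff_distrib mult.commute)
    finally show ?thesis .
  qed
  have FG: "F * G \<noteq> 0" "subdegree (F * G) = 2" "fps_nth (F * G) 2 = 1"
  proof -
    show "F * G \<noteq> 0" using F G by auto
    then show "subdegree (F * G) = 2" using F G subdegree_mult[of F G] by auto
    show "fps_nth (F * G) 2 = 1" using F G nth_subdegree_mult[of F G] by (auto simp: numeral_2_eq_2)
  qed
  have PQ: "P - Q \<noteq> 0" using eq ne by auto
  have deg: "subdegree (P - Q) + 2 = subdegree (F - G) + 1"
    using arg_cong[OF eq, of subdegree] FG PQ ne by simp
  have "subdegree (P - Q) > 0" using PQ P0 Q0 by (simp add: subdegree_eq_0_iff zero_less_iff_neq_zero)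
  then show "subdegree (F - G) \<ge> 2" using deg by simp
  have "fps_nth ((P - Q) * (F * G)) (subdegree (P - Q) + 2) = fps_nth (P - Q) (subdegree (P - Q))"
    using nth_subdegree_mult[of "P - Q" "F * G"] FG by simp
  moreover have "fps_nth (- (fps_X * (F - G))) (subdegree (F - G) + 1) = - fps_nth (F - G) (subdegree (F - G))"
    by simp
  moreover have "subdegree (P - Q) = subdegree (F - G) - 1" using deg by simp
  ultimately show "fps_nth (P - Q) (subdegree (F - G) - 1) = - fps_nth (F - G) (subdegree (F - G))"
    using eq deg by simp
qed

section \<open>Finiteness\<close>

lemma uniform_discrete_finite_Int_cball:
  fixes E :: "'a::heine_borel set"
  assumes "uniform_discrete E"
  shows "finite (E \<inter> cball a r)"
proof -
  have "compact (E \<inter> cball a r)"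
    using closed_Int_compact[OF uniform_discrete_imp_closed[OF assms] compact_cball] .
  moreover have "discrete (E \<inter> cball a r)"
    using assms by (meson uniform_discrete_imp_discrete discrete_subset inf_le1)
  ultimately show ?thesis using discrete_compact_finite_iff by blast
qed

lemma class_A_eqI:
  assumes "f \<in> class_A" "g \<in> class_A" "fps_expansion f 0 = fps_expansion g 0"
  shows "f = g"
proof (rule extensionalityI[of _ unit_disc])
  show "f z = g z" if "z \<in> unit_disc" for z
    using class_A_sums[OF assms(1) that] class_A_sums[OF assms(2) that] assms(3)
    by (simp add: sums_unique2)
qed (use assms in \<open>auto simp: class_A_def\<close>)

theorem theorem1p1:
  fixes E :: "complex set"
  assumes "uniform_discrete E"
  shows "finite (class_S_coeffs E)"
proof -
  obtain r where r: "r > 0" "\<And>x y. x \<in> E \<Longrightarrow> y \<in> E \<Longrightarrow> dist x y < r \<Longrightarrow> x = y"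
    using assms unfolding uniform_discrete_def by blast
  \<comment> \<open>a first difference at index \<open>k + 2\<close> needs \<open>r \<le> 2 * sqrt (6 / k)\<close>, that is \<open>k \<le> 24 / r\<^sup>2\<close>\<close>
  define K where "K = nat \<lceil>24 / r\<^sup>2\<rceil> + 2"
  define a where "a f n = fps_nth (fps_expansion f 0) n" for f :: "complex \<Rightarrow> complex" and n
  have determined: "f = g" if f: "f \<in> class_S_coeffs E" and g: "g \<in> class_S_coeffs E"
    and fg: "\<And>n. n \<le> K \<Longrightarrow> a f n = a g n" for f g
  proof (rule ccontr)
    assume "f \<noteq> g"
    let ?F = "fps_expansion f 0" and ?G = "fps_expansion g 0"
    have ne: "?F \<noteq> ?G"
      using class_A_eqI[of f g] f g \<open>f \<noteq> g\<close> by (auto simp: class_S_coeffs_def class_A_coeffs_def)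
    have S: "f \<in> class_S" "g \<in> class_S" using f g by (simp_all add: class_S_coeffs_def)
    obtain P where P: "P * ?F = fps_X" "fps_nth P 0 = 1"
      "\<And>k. k > 0 \<Longrightarrow> norm (fps_nth P k) \<le> 7"
      "\<And>k. k > 0 \<Longrightarrow> real k * (norm (fps_nth P (Suc k)))\<^sup>2 \<le> 6"
      using class_S_coefficient_data[OF S(1)] by blast
    obtain Q where Q: "Q * ?G = fps_X" "fps_nth Q 0 = 1"
      "\<And>k. k > 0 \<Longrightarrow> norm (fps_nth Q k) \<le> 7"
      "\<And>k. k > 0 \<Longrightarrow> real k * (norm (fps_nth Q (Suc k)))\<^sup>2 \<le> 6"
      using class_S_coefficient_data[OF S(2)] by blast
    define N where "N = subdegree (?F - ?G)"
    note diff = reciprocal_first_difference[OF P(1) Q(1) P(2) Q(2) ne, folded N_def]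
    have aN: "a f N \<noteq> a g N"
      using nth_subdegree_nonzero[of "?F - ?G"] ne by (auto simp: N_def a_def)
    then have "N > K" using fg by (meson not_le)
    define k where "k = N - 2"
    have k: "k > 0" "N - 1 = Suc k" "real k > 24 / r\<^sup>2"
      using \<open>N > K\<close> unfolding k_def K_def by (linarith+)
    have "a f N \<in> E" "a g N \<in> E"
      using f g diff(2) by (auto simp: class_S_coeffs_def class_A_coeffs_def a_def)
    then have "r \<le> norm (a f N - a g N)"
      using r(2)[of "a f N" "a g N"] aN by (force simp: dist_norm)
    also have "\<dots> = norm (fps_nth P (Suc k) - fps_nth Q (Suc k))"
      using diff(1) unfolding k(2) by (simp add: a_def norm_minus_commute)
    also have "\<dots> \<le> norm (fps_nth P (Suc k)) + norm (fps_nth Q (Suc k))"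
      by (rule norm_triangle_ineq4)
    finally have "r\<^sup>2 \<le> (norm (fps_nth P (Suc k)) + norm (fps_nth Q (Suc k)))\<^sup>2"
      using r(1) by (intro power_mono) auto
    also have "\<dots> \<le> 2 * (norm (fps_nth P (Suc k)))\<^sup>2 + 2 * (norm (fps_nth Q (Suc k)))\<^sup>2"
      using sum_squares_bound[of "norm (fps_nth P (Suc k))" "norm (fps_nth Q (Suc k))"]
      by (simp add: power2_sum)
    finally have "real k * r\<^sup>2 \<le> real k * (2 * (norm (fps_nth P (Suc k)))\<^sup>2 + 2 * (norm (fps_nth Q (Suc k)))\<^sup>2)"
      by (intro mult_left_mono) auto
    also have "\<dots> \<le> 24" using P(4)[OF k(1)] Q(4)[OF k(1)] by (simp add: algebra_simps)
    finally show False using k(3) r(1) by (simp add: field_simps)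
  qed
  \<comment> \<open>the points \<open>0\<close> and \<open>1\<close> are the coefficients of index \<open>0\<close> and \<open>1\<close>, which need not lie
    in \<open>E\<close>; the radius comes from \<open>reciprocal_coefficient_growth\<close> with \<open>B = 7\<close>\<close>
  define V where "V n = insert 0 (insert 1 (E \<inter> cball 0 (8 ^ n)))" for n :: nat
  have "inj_on (\<lambda>f. restrict (a f) {..K}) (class_S_coeffs E)"
  proof (rule inj_onI)
    fix f g assume fg: "f \<in> class_S_coeffs E" "g \<in> class_S_coeffs E"
      "restrict (a f) {..K} = restrict (a g) {..K}"
    show "f = g"
    proof (rule determined[OF fg(1,2)])
      show "a f n = a g n" if "n \<le> K" for n
        using fun_cong[OF fg(3), of n] that by simp
    qed
  qed
  moreover have "(\<lambda>f. restrict (a f) {..K}) ` class_S_coeffs E \<subseteq> PiE {..K} V"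
  proof (intro image_subsetI restrict_PiE_iff[THEN iffD2] ballI)
    fix f and n :: nat assume f: "f \<in> class_S_coeffs E"
    consider "n = 0" | "n = 1" | "n \<ge> 2" by linarith
    then show "a f n \<in> V n"
    proof cases
      case 3
      obtain P where P: "P * fps_expansion f 0 = fps_X" "fps_nth P 0 = 1"
        "\<And>k. k > 0 \<Longrightarrow> norm (fps_nth P k) \<le> 7"
        "\<And>k. k > 0 \<Longrightarrow> real k * (norm (fps_nth P (Suc k)))\<^sup>2 \<le> 6"
        using class_S_coefficient_data[of f] f unfolding class_S_coeffs_def by blast
      have "norm (a f n) \<le> 8 ^ (n - 1)"
        using reciprocal_coefficient_growth[OF P(1-3), of "n - 1"] 3 by (simp add: a_def)
      also have "\<dots> \<le> 8 ^ n" by (intro power_increasing) auto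
      finally show ?thesis using f 3
        by (auto simp: V_def a_def class_S_coeffs_def class_A_coeffs_def)
    qed (use f in \<open>auto simp: V_def a_def fps_expansion_def class_S_coeffs_def class_S_def class_A_def\<close>)
  qed
  moreover have "finite (PiE {..K} V)"
    using uniform_discrete_finite_Int_cball[OF assms] by (intro finite_PiE) (auto simp: V_def)
  ultimately show ?thesis by (rule inj_on_finite)
qed

end
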